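(* Let a $4$-periodic convex billiard trajectory within an ellipse $\mathcal{E}$ be given. Then: \begin{itemize} \item its caustic is an ellipse; \item the trajectory is a parallelogram; \item the tangent lines to $\mathcal{E}$ at the four reflection points form a rectangle (i.e. they are the lines containing the sides of a rectangle); \item the parallelogram is also a closed billiard trajectory within that rectangle; \item the diagonals of the rectangle are parallel to the sides of the parallelogram. \end{itemize}
   Context: A billiard trajectory within an ellipse $\mathcal{E}$ is a polygonal line with all vertices on $\mathcal{E}$ such that any two consecutive sides satisfy the billiard reflection law at their common vertex: they form congruent angles with the tangent line to $\mathcal{E}$ at that vertex (equivalently, the tangent line is the bisector of the exterior angle formed by the two sides). A $4$-periodic trajectory is a closed one with four vertices, the reflection law holding at each of them; it is convex if it is a (nondegenerate) convex quadrilateral. For a polygonal table (such as a rectangle), a closed billiard trajectory is a closed polygonal line with vertices on the sides of the table (not at its vertices), such that at each vertex the two consecutive sides of the trajectory form congruent angles with the side of the table containing that vertex. The caustic of a billiard trajectory within $\mathcal{E}$ is a conic confocal with $\mathcal{E}$ such that each segment of the trajectory lies on a tangent line of that conic. Circles are regarded as ellipses with coinciding foci (confocal with a circle then means concentric). *)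

theory Defs
  imports "HOL-Analysis.Analysis"
begin

type_synonym plane = "real ^ 2"

definition ellipse :: "plane \<Rightarrow> plane \<Rightarrow> real \<Rightarrow> plane set"
  where "ellipse F1 F2 a = {p. dist p F1 + dist p F2 = 2 * a}"

definition hyperbola :: "plane \<Rightarrow> plane \<Rightarrow> real \<Rightarrow> plane set"
  where "hyperbola F1 F2 a = {p. \<bar>dist p F1 - dist p F2\<bar> = 2 * a}"

text \<open>Both predicates exclude the degenerate members of the confocal family.  For \<open>F1 = F2\<close>
  the ellipses are the circles centred at that point, and there are no hyperbolas.\<close>

definition is_ellipse :: "plane \<Rightarrow> plane \<Rightarrow> plane set \<Rightarrow> bool"
  where "is_ellipse F1 F2 K \<longleftrightarrow> (\<exists>a. dist F1 F2 < 2 * a \<and> K = ellipse F1 F2 a)"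

definition is_hyperbola :: "plane \<Rightarrow> plane \<Rightarrow> plane set \<Rightarrow> bool"
  where "is_hyperbola F1 F2 K \<longleftrightarrow>
    (\<exists>a. 0 < 2 * a \<and> 2 * a < dist F1 F2 \<and> K = hyperbola F1 F2 a)"

definition is_conic :: "plane \<Rightarrow> plane \<Rightarrow> plane set \<Rightarrow> bool"
  where "is_conic F1 F2 K \<longleftrightarrow> is_ellipse F1 F2 K \<or> is_hyperbola F1 F2 K"

text \<open>The affine tangent space of a curve \<open>K\<close> at \<open>p \<in> K\<close>: all \<open>p + v\<close> with \<open>v\<close> the velocity at
  \<open>p\<close> of a path in \<open>K\<close>, the zero velocity included.  It is empty if \<open>p \<notin> K\<close>.\<close>

definition tangent_line :: "plane set \<Rightarrow> plane \<Rightarrow> plane set"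
  where "tangent_line K p = {p + v | v. \<exists>\<gamma> :: real \<Rightarrow> plane.
    (\<forall>t. \<gamma> t \<in> K) \<and> \<gamma> 0 = p \<and> (\<gamma> has_vector_derivative v) (at 0)}"

text \<open>The angle at the middle point, between \<open>0\<close> and \<open>pi\<close>.\<close>

definition angle :: "plane \<Rightarrow> plane \<Rightarrow> plane \<Rightarrow> real"
  where "angle X P Y = arccos (((X - P) \<bullet> (Y - P)) / (norm (X - P) * norm (Y - P)))"

text \<open>The sides \<open>PX\<close> and \<open>PY\<close> form congruent angles with the two opposite rays \<open>PS\<close> and \<open>PT\<close>
  of the line \<open>l\<close>.\<close>

definition reflection_law :: "plane set \<Rightarrow> plane \<Rightarrow> plane \<Rightarrow> plane \<Rightarrow> bool"
  where "reflection_law l X P Y \<longleftrightarrow> X \<noteq> P \<and> Y \<noteq> P \<and>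
    (\<exists>S\<in>l. \<exists>T\<in>l. P \<in> open_segment S T \<and> angle X P S = angle Y P T)"

definition sides :: "plane \<Rightarrow> plane \<Rightarrow> plane \<Rightarrow> plane \<Rightarrow> (plane \<times> plane) set"
  where "sides A B C D = {(A, B), (B, C), (C, D), (D, A)}"

text \<open>The vertices, each in the middle of a triple with its two neighbours.\<close>

definition corners :: "plane \<Rightarrow> plane \<Rightarrow> plane \<Rightarrow> plane \<Rightarrow> (plane \<times> plane \<times> plane) set"
  where "corners A B C D = {(D, A, B), (A, B, C), (B, C, D), (C, D, A)}"

definition convex_quadrilateral :: "plane \<Rightarrow> plane \<Rightarrow> plane \<Rightarrow> plane \<Rightarrow> bool"
  where "convex_quadrilateral A B C D \<longleftrightarrow>
    (\<forall>(X, P, Y) \<in> corners A B C D. \<not> collinear {X, P, Y}) \<and>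
    open_segment A C \<inter> open_segment B D \<noteq> {}"

definition billiard_in_ellipse ::
    "plane set \<Rightarrow> plane \<Rightarrow> plane \<Rightarrow> plane \<Rightarrow> plane \<Rightarrow> bool"
  where "billiard_in_ellipse E A B C D \<longleftrightarrow>
    (\<forall>(X, P, Y) \<in> corners A B C D. P \<in> E \<and> reflection_law (tangent_line E P) X P Y)"

definition caustic ::
    "plane \<Rightarrow> plane \<Rightarrow> plane \<Rightarrow> plane \<Rightarrow> plane \<Rightarrow> plane \<Rightarrow> plane set \<Rightarrow> bool"
  where "caustic F1 F2 A B C D K \<longleftrightarrow> is_conic F1 F2 K \<and>
    (\<forall>(X, Y) \<in> sides A B C D. \<exists>p\<in>K. closed_segment X Y \<subseteq> tangent_line K p)"

definition parallel :: "plane \<Rightarrow> plane \<Rightarrow> plane \<Rightarrow> plane \<Rightarrow> bool"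
  where "parallel X Y Z W \<longleftrightarrow> X \<noteq> Y \<and> Z \<noteq> W \<and> (\<exists>k. W - Z = k *\<^sub>R (Y - X))"

definition parallelogram :: "plane \<Rightarrow> plane \<Rightarrow> plane \<Rightarrow> plane \<Rightarrow> bool"
  where "parallelogram A B C D \<longleftrightarrow>
    \<not> collinear {A, B, C} \<and> parallel A B C D \<and> parallel B C D A"

definition rectangle :: "plane \<Rightarrow> plane \<Rightarrow> plane \<Rightarrow> plane \<Rightarrow> bool"
  where "rectangle A B C D \<longleftrightarrow> parallelogram A B C D \<and> orthogonal (B - A) (D - A)"

text \<open>Closed trajectory \<open>ABCD\<close> within the convex quadrilateral table \<open>QRST\<close>; the open segments
  keep the reflection points away from the vertices of the table.\<close>

definition billiard_in_table :: "plane \<Rightarrow> plane \<Rightarrow> plane \<Rightarrow> plane \<Rightarrow>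
    plane \<Rightarrow> plane \<Rightarrow> plane \<Rightarrow> plane \<Rightarrow> bool"
  where "billiard_in_table Q R S T A B C D \<longleftrightarrow>
    (\<forall>(X, P, Y) \<in> corners A B C D. \<exists>(U, V) \<in> sides Q R S T.
      P \<in> open_segment U V \<and> reflection_law (affine hull {U, V}) X P Y)"

end

theory Submission
  imports Defs
begin

text \<open>
  In coordinates in which the ellipse is the set of the points \<open>(a x, b y)\<close> with \<open>x\<^sup>2 + y\<^sup>2 = 1\<close>, the
  reflection law implies that the square \<open>J\<close> of Joachimsthal's integral is the same for two
  consecutive sides.  For a side joining \<open>(a x, b y)\<close> to \<open>(a x', b y')\<close> this is the equation
  \<open>(1 - J c\<^sup>2) x x' + (1 + J c\<^sup>2) y y' = 1 - J (a\<^sup>2 + b\<^sup>2)\<close>.  For a fixed vertex it is linear in the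
  neighbours, so in a 4-periodic trajectory \<open>A\<close> and \<open>C\<close> both have the line \<open>BD\<close> as their polar
  line with respect to this equation, and vice versa.  As \<open>A \<noteq> C\<close>, \<open>B \<noteq> D\<close> and the diagonals
  cross, the right-hand side vanishes;
  then \<open>C = - A\<close>, \<open>D = - B\<close>, and the equation becomes the orthogonality of the tangent
  lines at \<open>A\<close> and \<open>B\<close>.  The tangent lines thus meet on the director circle
  \<open>X\<^sup>2 + Y\<^sup>2 = a\<^sup>2 + b\<^sup>2\<close>, at multiples of \<open>A + B\<close> and \<open>B - A\<close>, and the sides touch the confocal
  ellipse with semi-axes \<open>a\<^sup>2 / h\<close> and \<open>b\<^sup>2 / h\<close>, where \<open>h\<^sup>2 = a\<^sup>2 + b\<^sup>2\<close>.  A line touches only one conic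
  of a confocal family, so no hyperbola is a caustic.
\<close>

subsection \<open>Lines and reflection\<close>

text \<open>The two angles have equal cosines. Squaring these cancels the factors \<open>s\<close>
  and \<open>t\<close> together with their signs, so that only the direction \<open>v\<close> of the
  line remains.\<close>

lemma reflection_law_squares:
  fixes v :: plane
  assumes refl: "reflection_law l X P Y"
    and l: "\<And>S. S \<in> l \<Longrightarrow> \<exists>r. S = P + r *\<^sub>R v"
  shows "((X - P) \<bullet> v)\<^sup>2 * (norm (Y - P))\<^sup>2 = ((Y - P) \<bullet> v)\<^sup>2 * (norm (X - P))\<^sup>2"
proof -
  obtain S T where XP: "X \<noteq> P" "Y \<noteq> P" and ST: "S \<in> l" "T \<in> l" "P \<in> open_segment S T"
    and ang: "angle X P S = angle Y P T"
    using refl unfolding reflection_law_def by blast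
  obtain s t where s: "S = P + s *\<^sub>R v" and t: "T = P + t *\<^sub>R v"
    using l ST by blast
  have "S \<noteq> P" "T \<noteq> P" using ST(3) by (auto simp: open_segment_def)
  then have nz: "s \<noteq> 0" "t \<noteq> 0" "v \<noteq> 0" using s t by auto
  \<comment> \<open>\<open>arccos\<close> is injective only on [-1, 1]; Cauchy-Schwarz puts both
    quotients there, the quotient for a zero vector being \<open>0\<close>.\<close>
  have bound: "\<bar>(W \<bullet> V) / (norm W * norm V)\<bar> \<le> 1" for W V :: plane
    using Cauchy_Schwarz_ineq2[of W V] by (cases "W = 0 \<or> V = 0") (auto simp: divide_le_eq_1)
  have "((X - P) \<bullet> (S - P)) / (norm (X - P) * norm (S - P)) =
        ((Y - P) \<bullet> (T - P)) / (norm (Y - P) * norm (T - P))"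
    using ang bound unfolding angle_def by (simp add: arccos_eq_iff)
  then have "(((X - P) \<bullet> (S - P)) / (norm (X - P) * norm (S - P)))\<^sup>2 =
        (((Y - P) \<bullet> (T - P)) / (norm (Y - P) * norm (T - P)))\<^sup>2"
    by simp
  then show ?thesis
    using XP nz by (simp add: s t power_divide power_mult_distrib field_simps)
qed

lemma line_through_points:
  fixes P v :: plane
  assumes Q: "Q = P + s *\<^sub>R v" and R: "R = P + t *\<^sub>R v" and st: "s < 0" "0 < t" and v: "v \<noteq> 0"
  shows "affine hull {Q, R} = {P + r *\<^sub>R v |r. True}" and "P \<in> open_segment Q R"
proof -
  have one: "(t - r) / (t - s) + (r - s) / (t - s) = 1" for r
    using st by (simp flip: add_divide_distrib)
  have comb: "P + r *\<^sub>R v = ((t - r) / (t - s)) *\<^sub>R Q + ((r - s) / (t - s)) *\<^sub>R R" for r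
  proof -
    have "((t - r) / (t - s)) *\<^sub>R Q + ((r - s) / (t - s)) *\<^sub>R R =
        ((t - r) / (t - s) + (r - s) / (t - s)) *\<^sub>R P
        + (((t - r) / (t - s)) * s + ((r - s) / (t - s)) * t) *\<^sub>R v"
      by (simp add: Q R algebra_simps)
    moreover have "((t - r) / (t - s)) * s + ((r - s) / (t - s)) * t = r"
    proof -
      have "((t - r) / (t - s)) * s + ((r - s) / (t - s)) * t
          = ((t - r) * s + (r - s) * t) / (t - s)"
        by (simp add: add_divide_distrib)
      also have "(t - r) * s + (r - s) * t = r * (t - s)" by algebra
      finally show ?thesis using st by simp
    qed
    ultimately show ?thesis using one by simp
  qed
  show "affine hull {Q, R} = {P + r *\<^sub>R v |r. True}"
  proof (intro equalityI subsetI)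
    fix z assume "z \<in> affine hull {Q, R}"
    then obtain k l where kl: "z = k *\<^sub>R Q + l *\<^sub>R R" "k + l = 1"
      by (auto simp: affine_hull_2)
    have "z = (k + l) *\<^sub>R P + (k * s + l * t) *\<^sub>R v"
      by (simp add: kl(1) Q R algebra_simps)
    then show "z \<in> {P + r *\<^sub>R v |r. True}" unfolding kl(2) by auto
  next
    fix z assume "z \<in> {P + r *\<^sub>R v |r. True}"
    then obtain r where "z = P + r *\<^sub>R v" by auto
    then show "z \<in> affine hull {Q, R}"
      unfolding affine_hull_2 using comb[of r] one[of r] by blast
  qed
  have "P = (1 - (- s) / (t - s)) *\<^sub>R Q + ((- s) / (t - s)) *\<^sub>R R"
    using comb[of 0] one[of 0] by (simp add: eq_diff_eq)
  moreover have "0 < (- s) / (t - s)" "(- s) / (t - s) < 1"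
    using st by (simp_all only: zero_less_divide_iff pos_divide_less_eq) auto
  moreover have "Q \<noteq> R" using Q R st v by auto
  ultimately show "P \<in> open_segment Q R" unfolding in_segment by blast
qed

lemma orthogonal_imp_not_collinear:
  fixes A B C :: plane
  assumes "orthogonal (A - B) (C - B)" "A \<noteq> B" "C \<noteq> B"
  shows "\<not> collinear {A, B, C}"
  using assms by (auto simp: collinear_3[of A] collinear_lemma orthogonal_def)

lemma not_collinear_distinct:
  assumes "\<not> collinear {A, B, C}"
  shows "A \<noteq> B" "B \<noteq> C" "A \<noteq> C"
  using assms by (auto simp: insert_commute)

subsection \<open>Points on the unit circle\<close>

text \<open>For points at the angles p and q, (cos q - cos p)^2 = (1 - cos (p - q)) (1 - cos (p +
  q)), and for the sines the last factor is 1 + cos (p + q). The left-hand side is the squared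
  length of a chord of the ellipse.\<close>

lemma unit_circle_chord:
  fixes x y x' y' a b :: real
  assumes "x\<^sup>2 + y\<^sup>2 = 1" "x'\<^sup>2 + y'\<^sup>2 = 1"
  shows "a\<^sup>2 * (x' - x)\<^sup>2 + b\<^sup>2 * (y' - y)\<^sup>2
    = (1 - x * x' - y * y') * (a\<^sup>2 + b\<^sup>2 - (a\<^sup>2 - b\<^sup>2) * (x * x' - y * y'))"
proof -
  have "(x' - x)\<^sup>2 = (1 - x * x' - y * y') * (1 - (x * x' - y * y'))" using assms by algebra
  moreover have "(y' - y)\<^sup>2 = (1 - x * x' - y * y') * (1 + (x * x' - y * y'))" using assms by algebra
  ultimately show ?thesis by algebra
qed

lemma unit_circle_inner_less:
  fixes x y x' y' :: real
  assumes "x\<^sup>2 + y\<^sup>2 = 1" "x'\<^sup>2 + y'\<^sup>2 = 1" "x \<noteq> x' \<or> y \<noteq> y'"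
  shows "x * x' + y * y' < 1"
proof -
  have "0 < (x' - x)\<^sup>2 + (y' - y)\<^sup>2"
    using assms(3) by (metis eq_iff_diff_eq_0 sum_power2_gt_zero_iff)
  also have "\<dots> = 2 - 2 * (x * x' + y * y')" using assms(1,2) by algebra
  finally show ?thesis by simp
qed

text \<open>Both points lie on one line through the origin, which meets the circle in an antipodal
  pair.\<close>

lemma unit_circle_antipodal:
  fixes x y x' y' p q :: real
  assumes "x\<^sup>2 + y\<^sup>2 = 1" "x'\<^sup>2 + y'\<^sup>2 = 1" "x \<noteq> x' \<or> y \<noteq> y'"
    and "p * x + q * y = 0" "p * x' + q * y' = 0" "p \<noteq> 0 \<or> q \<noteq> 0"
  shows "x' = - x \<and> y' = - y"
proof -
  have "p * (x * y' - x' * y) = 0" "q * (x * y' - x' * y) = 0"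
    using assms(4,5) by algebra+
  then have det: "x * y' = x' * y" using assms(6) by auto
  define k where "k = x * x' + y * y'"
  have k: "x' = k * x" "y' = k * y" using det assms(1,2) unfolding k_def by algebra+
  have "k\<^sup>2 = 1" using k assms(1,2) by algebra
  then have "k = 1 \<or> k = -1" by (simp add: power2_eq_1_iff)
  then show ?thesis using k assms(3) by auto
qed

text \<open>By subtraction, \<open>(al * (x1 - x3), be * (y1 - y3))\<close> is orthogonal to points
  0 and 2. If it is nonzero, these are antipodal, and the two equations at point 1 give
  \<open>ga = - ga\<close>. The other diagonal is treated alike, so for \<open>ga \<noteq> 0\<close>
  both vectors vanish. As \<open>be \<noteq> 0\<close>, both diagonals are then horizontal, and
  \<open>cross\<close> puts all four points at one height, where the circle has at most two.\<close>

lemma common_polar_line: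
  fixes al be ga :: real
  assumes unit: "x0\<^sup>2 + y0\<^sup>2 = 1" "x1\<^sup>2 + y1\<^sup>2 = 1" "x2\<^sup>2 + y2\<^sup>2 = 1" "x3\<^sup>2 + y3\<^sup>2 = 1"
    and ne: "x0 \<noteq> x2 \<or> y0 \<noteq> y2" "x1 \<noteq> x3 \<or> y1 \<noteq> y3"
      "x0 \<noteq> x1 \<or> y0 \<noteq> y1" "x1 \<noteq> x2 \<or> y1 \<noteq> y2"
    and be: "be \<noteq> 0"
    and e01: "al * (x0 * x1) + be * (y0 * y1) = ga"
    and e12: "al * (x1 * x2) + be * (y1 * y2) = ga"
    and e23: "al * (x2 * x3) + be * (y2 * y3) = ga"
    and e30: "al * (x3 * x0) + be * (y3 * y0) = ga"
    and cross: "y0 = y2 \<Longrightarrow> y1 = y3 \<Longrightarrow> y0 = y1"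
  shows "ga = 0"
proof (rule ccontr)
  assume ga: "ga \<noteq> 0"
  have 1: "al * (x1 - x3) = 0 \<and> be * (y1 - y3) = 0"
  proof (rule ccontr)
    assume "\<not> ?thesis"
    then have "al * (x1 - x3) \<noteq> 0 \<or> be * (y1 - y3) \<noteq> 0" by blast
    moreover have "al * (x1 - x3) * x0 + be * (y1 - y3) * y0 = 0"
      "al * (x1 - x3) * x2 + be * (y1 - y3) * y2 = 0"
      using e01 e12 e23 e30 by (simp_all add: algebra_simps)
    ultimately have "x2 = - x0 \<and> y2 = - y0"
      using unit_circle_antipodal[OF unit(1,3) ne(1)] by blast
    then show False using e01 e12 ga by (auto simp: algebra_simps)
  qed
  have 2: "al * (x0 - x2) = 0 \<and> be * (y0 - y2) = 0"
  proof (rule ccontr)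
    assume "\<not> ?thesis"
    then have "al * (x0 - x2) \<noteq> 0 \<or> be * (y0 - y2) \<noteq> 0" by blast
    moreover have "al * (x0 - x2) * x1 + be * (y0 - y2) * y1 = 0"
      "al * (x0 - x2) * x3 + be * (y0 - y2) * y3 = 0"
      using e01 e12 e23 e30 by (simp_all add: algebra_simps)
    ultimately have "x3 = - x1 \<and> y3 = - y1"
      using unit_circle_antipodal[OF unit(2,4) ne(2)] by blast
    then show False using e30 e01 ga by (auto simp: algebra_simps)
  qed
  have y: "y0 = y2" "y1 = y3" "y0 = y1" using 1 2 be cross by auto
  then have "x1\<^sup>2 = x0\<^sup>2" "x2\<^sup>2 = x0\<^sup>2" using unit by auto
  then show False using y ne by (auto simp: power2_eq_iff)
qed

text \<open>Covers \<open>r1 + r2 = 2 s\<close> and \<open>r1 - r2 = \<plusminus> 2 s\<close> at once: ellipses and hyperbolas of a confocal family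
  satisfy the same quadratic equation.\<close>

lemma focal_distances_quadric:
  fixes r1 r2 s c x y :: real
  assumes "r1\<^sup>2 = (x + c)\<^sup>2 + y\<^sup>2" "r2\<^sup>2 = (x - c)\<^sup>2 + y\<^sup>2"
    and "r2\<^sup>2 = (2 * s - r1)\<^sup>2"
  shows "(s\<^sup>2 - c\<^sup>2) * x\<^sup>2 + s\<^sup>2 * y\<^sup>2 = s\<^sup>2 * (s\<^sup>2 - c\<^sup>2)"
proof -
  \<comment> \<open>The difference of the squared distances makes the focal distance linear in
    \<open>x\<close>.\<close>
  have "s * r1 = s\<^sup>2 + c * x" using assms by algebra
  then have "s\<^sup>2 * ((x + c)\<^sup>2 + y\<^sup>2) = (s\<^sup>2 + c * x)\<^sup>2" using assms(1) by algebra
  then show ?thesis by algebra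
qed

section \<open>Orthogonal tangent lines\<close>

text \<open>The tangent directions at the two points of the ellipse are \<open>(- a y, b x)\<close>
  and \<open>(- a y', b x')\<close>, so the last hypothesis is their orthogonality. The conclusion
  puts the intersection point of the tangent lines on the director circle, with denominators
  cleared.\<close>

lemma director_circle:
  fixes a b x y x' y' :: real
  assumes "x\<^sup>2 + y\<^sup>2 = 1" "x'\<^sup>2 + y'\<^sup>2 = 1" "b\<^sup>2 * (x * x') + a\<^sup>2 * (y * y') = 0"
  shows "a\<^sup>2 * (x + x')\<^sup>2 + b\<^sup>2 * (y + y')\<^sup>2 = (a\<^sup>2 + b\<^sup>2) * (1 + x * x' + y * y')\<^sup>2"
  using assms by algebra

text \<open>Equal or antipodal points have parallel tangent lines, which cannot be orthogonal. The
  bounds keep the later denominators \<open>1 + m\<close> and \<open>1 - m\<close> positive.\<close>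

lemma conjugate_bounds:
  fixes x y x' y' :: real
  assumes "0 < a" "0 < b" "x\<^sup>2 + y\<^sup>2 = 1" "x'\<^sup>2 + y'\<^sup>2 = 1" "b\<^sup>2 * (x * x') + a\<^sup>2 * (y * y') = 0"
  shows "x * y' - x' * y \<noteq> 0" "- 1 < x * x' + y * y'" "x * x' + y * y' < 1"
proof -
  define m where "m = x * x' + y * y'"
  show d: "x * y' - x' * y \<noteq> 0"
  proof
    assume "x * y' - x' * y = 0"
    then have x': "x' = m * x" "y' = m * y" using assms(3) unfolding m_def by algebra+
    then have "m * (b\<^sup>2 * x\<^sup>2 + a\<^sup>2 * y\<^sup>2) = 0" using assms(5) by algebra
    moreover have "b\<^sup>2 * x\<^sup>2 + a\<^sup>2 * y\<^sup>2 > 0"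
    proof (cases "x = 0")
      case True
      then show ?thesis using assms(1,3) by simp
    next
      case False
      then have "0 < b\<^sup>2 * x\<^sup>2" using assms(2) by simp
      then show ?thesis by (simp add: add_pos_nonneg)
    qed
    ultimately have "m = 0" by simp
    then show False using x' assms(4) by simp
  qed
  have "(x * y' - x' * y)\<^sup>2 + m\<^sup>2 = 1" using assms(3,4) unfolding m_def by algebra
  moreover have "(x * y' - x' * y)\<^sup>2 > 0" using d by simp
  ultimately have "m\<^sup>2 < 1" by linarith
  then have "\<bar>m\<bar> < 1" by (simp add: abs_square_less_1)
  then show "- 1 < x * x' + y * y'" "x * x' + y * y' < 1" unfolding m_def by linarith+
qed

lemma norm_tangent_meet:
  fixes a b x y x' y' :: real
  assumes ab: "0 < a" "0 < b" and unit: "x\<^sup>2 + y\<^sup>2 = 1" "x'\<^sup>2 + y'\<^sup>2 = 1"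
    and conj: "b\<^sup>2 * (x * x') + a\<^sup>2 * (y * y') = 0"
  shows "(a * ((x + x') / (1 + (x * x' + y * y'))))\<^sup>2 + (b * ((y + y') / (1 + (x * x' + y * y'))))\<^sup>2
    = a\<^sup>2 + b\<^sup>2"
proof -
  have "1 + (x * x' + y * y') \<noteq> 0" using conjugate_bounds(2)[OF assms] by simp
  then show ?thesis using director_circle[OF unit conj]
    by (simp add: power_mult_distrib power_divide add_divide_eq_iff divide_eq_eq add.assoc
        flip: add_divide_distrib)
qed

subsection \<open>Conics in principal axes\<close>

locale axes =
  fixes Z e1 e2 :: plane
  assumes e11: "e1 \<bullet> e1 = 1" and e22: "e2 \<bullet> e2 = 1" and e12: "e1 \<bullet> e2 = 0"
    and span: "v = (v \<bullet> e1) *\<^sub>R e1 + (v \<bullet> e2) *\<^sub>R e2"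
begin

definition pt :: "real \<Rightarrow> real \<Rightarrow> plane" where "pt u w = Z + u *\<^sub>R e1 + w *\<^sub>R e2"

lemma e21: "e2 \<bullet> e1 = 0" using e12 by (simp add: inner_commute)

lemma inner_frame: "(u *\<^sub>R e1 + w *\<^sub>R e2) \<bullet> (u' *\<^sub>R e1 + w' *\<^sub>R e2) = u * u' + w * w'"
  by (simp add: inner_add_left inner_add_right e11 e22 e12 e21)

lemma pt_diff: "pt u w - pt u' w' = (u - u') *\<^sub>R e1 + (w - w') *\<^sub>R e2"
  by (simp add: pt_def algebra_simps)

lemma pt_shift: "pt u w + r *\<^sub>R (u' *\<^sub>R e1 + w' *\<^sub>R e2) = pt (u + r * u') (w + r * w')"
  by (simp add: pt_def algebra_simps)

lemma norm_pt_diff: "(norm (pt u w - pt u' w'))\<^sup>2 = (u - u')\<^sup>2 + (w - w')\<^sup>2"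
  unfolding power2_norm_eq_inner pt_diff inner_frame by algebra

lemma pt_eq_iff: "pt u w = pt u' w' \<longleftrightarrow> u = u' \<and> w = w'"
proof -
  have "pt u w = pt u' w' \<longleftrightarrow> (norm (pt u w - pt u' w'))\<^sup>2 = 0" by simp
  then show ?thesis by (simp add: norm_pt_diff sum_power2_eq_zero_iff del: zero_eq_power2)
qed

lemma pt_combination:
  "k + l = 1 \<Longrightarrow> k *\<^sub>R pt u w + l *\<^sub>R pt u' w' = pt (k * u + l * u') (k * w + l * w')"
proof -
  assume "k + l = 1"
  then have "k *\<^sub>R Z + l *\<^sub>R Z = Z" by (metis scaleR_add_left scaleR_one)
  then show ?thesis by (simp add: pt_def algebra_simps)
qed

lemma scaled_coordinates:
  assumes "a > 0" "b > 0"
  obtains x y where "p = pt (a * x) (b * y)"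
proof
  show "p = pt (a * (((p - Z) \<bullet> e1) / a)) (b * (((p - Z) \<bullet> e2) / b))"
    using span[of "p - Z"] assms by (simp add: pt_def add.assoc)
qed

lemma coordinates: obtains u w where "p = pt u w"
  using scaled_coordinates[of 1 1] by auto

lemma coordinate_1: "(pt u w - Z) \<bullet> e1 = u"
  by (simp add: pt_def inner_add_left e11 e21)

lemma coordinate_2: "(pt u w - Z) \<bullet> e2 = w"
  by (simp add: pt_def inner_add_left e22 e12)

lemma dist_foci:
  "(dist (pt u w) (pt (- c) 0))\<^sup>2 = (u + c)\<^sup>2 + w\<^sup>2" "(dist (pt u w) (pt c 0))\<^sup>2 = (u - c)\<^sup>2 + w\<^sup>2"
  by (simp_all add: dist_norm norm_pt_diff)

lemma ellipse_iff:
  assumes "0 \<le> c" "c < a" "0 < b" "b\<^sup>2 = a\<^sup>2 - c\<^sup>2"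
  shows "pt (a * x) (b * y) \<in> ellipse (pt (- c) 0) (pt c 0) a \<longleftrightarrow> x\<^sup>2 + y\<^sup>2 = 1"
proof
  assume "pt (a * x) (b * y) \<in> ellipse (pt (- c) 0) (pt c 0) a"
  then have "dist (pt (a * x) (b * y)) (pt c 0) = 2 * a - dist (pt (a * x) (b * y)) (pt (- c) 0)"
    by (simp add: ellipse_def)
  then have "(a\<^sup>2 - c\<^sup>2) * (a * x)\<^sup>2 + a\<^sup>2 * (b * y)\<^sup>2 = a\<^sup>2 * (a\<^sup>2 - c\<^sup>2)"
    by (intro focal_distances_quadric[OF dist_foci]) simp
  then have "a\<^sup>2 * b\<^sup>2 * (x\<^sup>2 + y\<^sup>2 - 1) = 0" using assms(4) by algebra
  then show "x\<^sup>2 + y\<^sup>2 = 1" using assms by simp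
next
  assume xy: "x\<^sup>2 + y\<^sup>2 = 1"
  then have "x\<^sup>2 \<le> 1" by (smt (verit) zero_le_power2)
  then have "\<bar>x\<bar> \<le> 1" by (simp add: abs_square_le_1)
  then have "\<bar>c * x\<bar> \<le> c * 1" unfolding abs_mult using assms(1) by (intro mult_mono) auto
  then have cx: "0 \<le> a + c * x" "0 \<le> a - c * x" using assms(2) by linarith+
  \<comment> \<open>The focal distances are \<open>a + c * x\<close> and \<open>a - c * x\<close>;
    by \<open>cx\<close> both are nonnegative, so they can be read off from their squares.\<close>
  have "(dist (pt (a * x) (b * y)) (pt (- c) 0))\<^sup>2 = (a + c * x)\<^sup>2"
    unfolding dist_foci using xy assms(4) by algebra
  moreover have "(dist (pt (a * x) (b * y)) (pt c 0))\<^sup>2 = (a - c * x)\<^sup>2"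
    unfolding dist_foci using xy assms(4) by algebra
  ultimately have "dist (pt (a * x) (b * y)) (pt (- c) 0) = a + c * x"
    "dist (pt (a * x) (b * y)) (pt c 0) = a - c * x"
    using cx by (auto intro: power2_eq_imp_eq)
  then show "pt (a * x) (b * y) \<in> ellipse (pt (- c) 0) (pt c 0) a" by (simp add: ellipse_def)
qed

lemma hyperbola_imp_quadric:
  assumes "pt u w \<in> hyperbola (pt (- c) 0) (pt c 0) s"
  shows "(s\<^sup>2 - c\<^sup>2) * u\<^sup>2 + s\<^sup>2 * w\<^sup>2 = s\<^sup>2 * (s\<^sup>2 - c\<^sup>2)"
proof -
  \<comment> \<open>The outer minus disappears on squaring, and the two branches become the equation
    of an ellipse for \<open>s\<close> and for \<open>- s\<close>.\<close>
  have "dist (pt u w) (pt c 0) = - (2 * s - dist (pt u w) (pt (- c) 0)) \<or>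
      dist (pt u w) (pt c 0) = - (2 * (- s) - dist (pt u w) (pt (- c) 0))"
    using assms by (auto simp: hyperbola_def)
  then show ?thesis
  proof
    assume "dist (pt u w) (pt c 0) = - (2 * s - dist (pt u w) (pt (- c) 0))"
    then show ?thesis by (intro focal_distances_quadric[OF dist_foci]) (simp only: power2_minus)
  next
    assume "dist (pt u w) (pt c 0) = - (2 * (- s) - dist (pt u w) (pt (- c) 0))"
    then show ?thesis
      using focal_distances_quadric[OF dist_foci, where s = "- s" and x = u and y = w and c = c]
      by (simp only: power2_minus)
  qed
qed

section \<open>Tangent lines as polar lines\<close>

lemma quadric_velocity:
  assumes deriv: "(\<gamma> has_vector_derivative v) (at (0::real))"
    and on: "\<And>t. k * ((\<gamma> t - Z) \<bullet> e1)\<^sup>2 + l * ((\<gamma> t - Z) \<bullet> e2)\<^sup>2 = m"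
  shows "k * ((\<gamma> 0 - Z) \<bullet> e1) * (v \<bullet> e1) + l * ((\<gamma> 0 - Z) \<bullet> e2) * (v \<bullet> e2) = 0"
proof -
  have d: "((\<lambda>t. (\<gamma> t - Z) \<bullet> e) has_real_derivative v \<bullet> e) (at 0)" for e
  proof -
    have "((\<lambda>t. \<gamma> t - Z) has_vector_derivative v) (at 0)"
      using deriv by (auto intro!: derivative_eq_intros)
    from bounded_linear.has_vector_derivative[OF bounded_linear_inner_left this, of e]
    show ?thesis by (simp add: has_real_derivative_iff_has_vector_derivative)
  qed
  have "((\<lambda>t. k * ((\<gamma> t - Z) \<bullet> e1)\<^sup>2 + l * ((\<gamma> t - Z) \<bullet> e2)\<^sup>2) has_real_derivative
      2 * (k * ((\<gamma> 0 - Z) \<bullet> e1) * (v \<bullet> e1) + l * ((\<gamma> 0 - Z) \<bullet> e2) * (v \<bullet> e2))) (at 0)"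
    by (rule derivative_eq_intros d refl | simp add: algebra_simps)+
  moreover have "((\<lambda>t. k * ((\<gamma> t - Z) \<bullet> e1)\<^sup>2 + l * ((\<gamma> t - Z) \<bullet> e2)\<^sup>2) has_real_derivative 0) (at 0)"
    unfolding on by simp
  ultimately show ?thesis using DERIV_unique by fastforce
qed

text \<open>The tangent line is contained in the polar line, since velocities are orthogonal to the
  gradient. This inclusion needs no parametrisation of \<open>K\<close>, so it serves ellipses and
  hyperbolas alike.\<close>

lemma tangent_line_quadric:
  assumes on: "\<And>u w. pt u w \<in> K \<Longrightarrow> k * u\<^sup>2 + l * w\<^sup>2 = m"
    and q: "pt u' w' \<in> tangent_line K (pt u w)"
  shows "k * u * u' + l * w * w' = m"
proof -
  obtain \<gamma> v where \<gamma>: "\<And>t. \<gamma> t \<in> K" "\<gamma> 0 = pt u w" "(\<gamma> has_vector_derivative v) (at (0::real))"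
    and v: "pt u' w' = pt u w + v"
    using q unfolding tangent_line_def by auto
  have v': "v = (u' - u) *\<^sub>R e1 + (w' - w) *\<^sub>R e2" using v pt_diff by (metis add_diff_cancel_left')
  have "k * ((\<gamma> t - Z) \<bullet> e1)\<^sup>2 + l * ((\<gamma> t - Z) \<bullet> e2)\<^sup>2 = m" for t
    using \<gamma>(1)[of t] on by (metis coordinates coordinate_1 coordinate_2)
  from quadric_velocity[OF \<gamma>(3) this]
  have "k * u * (u' - u) + l * w * (w' - w) = 0"
    by (simp add: \<gamma>(2) coordinate_1 coordinate_2 v' inner_add_left e11 e22 e12 e21)
  moreover have "k * u\<^sup>2 + l * w\<^sup>2 = m" using on \<gamma>(1)[of 0] \<gamma>(2) by simp
  ultimately show ?thesis by algebra
qed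

lemma tangent_line_ellipse:
  assumes ab: "0 < a" "0 < b" and K: "\<And>x y. pt (a * x) (b * y) \<in> K \<longleftrightarrow> x\<^sup>2 + y\<^sup>2 = 1"
    and xy: "x\<^sup>2 + y\<^sup>2 = 1"
  shows "pt (a * u) (b * w) \<in> tangent_line K (pt (a * x) (b * y)) \<longleftrightarrow> x * u + y * w = 1"
    and "tangent_line K (pt (a * x) (b * y))
      = {pt (a * x) (b * y) + r *\<^sub>R ((- (a * y)) *\<^sub>R e1 + (b * x) *\<^sub>R e2) |r. True}"
proof -
  have fw: "x * u + y * w = 1"
    if "pt (a * u) (b * w) \<in> tangent_line K (pt (a * x) (b * y))" for u w
  proof -
    have "b\<^sup>2 * (a * x) * (a * u) + a\<^sup>2 * (b * y) * (b * w) = a\<^sup>2 * b\<^sup>2"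
    proof (rule tangent_line_quadric[OF _ that])
      fix u w assume "pt u w \<in> K"
      then have "(u / a)\<^sup>2 + (w / b)\<^sup>2 = 1" using K[of "u / a" "w / b"] ab by simp
      then show "b\<^sup>2 * u\<^sup>2 + a\<^sup>2 * w\<^sup>2 = a\<^sup>2 * b\<^sup>2" using ab by (simp add: field_simps)
    qed
    then have "a\<^sup>2 * b\<^sup>2 * (x * u + y * w - 1) = 0" by algebra
    then show ?thesis using ab by simp
  qed
  have dir: "pt (a * x) (b * y) + r *\<^sub>R ((- (a * y)) *\<^sub>R e1 + (b * x) *\<^sub>R e2)
      = pt (a * (x - r * y)) (b * (y + r * x))" for r
    unfolding pt_shift by (simp add: algebra_simps)
  have bw: "pt (a * x) (b * y) + r *\<^sub>R ((- (a * y)) *\<^sub>R e1 + (b * x) *\<^sub>R e2)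
      \<in> tangent_line K (pt (a * x) (b * y))" for r
  proof -
    \<comment> \<open>Rotating the unit circle with angular speed \<open>r\<close> gives a path with
      the prescribed velocity.\<close>
    define \<gamma> where "\<gamma> t = pt (a * (x * cos (r * t) - y * sin (r * t)))
        (b * (y * cos (r * t) + x * sin (r * t)))" for t
    have "(x * cos t - y * sin t)\<^sup>2 + (y * cos t + x * sin t)\<^sup>2 = 1" for t
      using xy sin_cos_squared_add[of t] by algebra
    then have "\<gamma> t \<in> K" for t by (simp add: \<gamma>_def K)
    moreover have "\<gamma> 0 = pt (a * x) (b * y)" by (simp add: \<gamma>_def)
    moreover have "(\<gamma> has_vector_derivative
        r *\<^sub>R ((- (a * y)) *\<^sub>R e1 + (b * x) *\<^sub>R e2)) (at 0)"
      unfolding \<gamma>_def[abs_def] pt_def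
      by (rule derivative_eq_intros refl | simp add: algebra_simps)+
    ultimately show ?thesis unfolding tangent_line_def by blast
  qed
  \<comment> \<open>The points with \<open>x u + y w = 1\<close> are
    \<open>(x, y) + t (- y, x)\<close>, where \<open>t\<close> is the determinant
    \<open>x w - y u\<close>.\<close>
  have line: "pt (a * u) (b * w) = pt (a * x) (b * y)
      + (x * w - y * u) *\<^sub>R ((- (a * y)) *\<^sub>R e1 + (b * x) *\<^sub>R e2)" if "x * u + y * w = 1" for u w
  proof -
    have "u = x - (x * w - y * u) * y" "w = y + (x * w - y * u) * x" using that xy by algebra+
    then show ?thesis unfolding dir by metis
  qed
  show "pt (a * u) (b * w) \<in> tangent_line K (pt (a * x) (b * y)) \<longleftrightarrow> x * u + y * w = 1"
    using fw bw line by metis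
  show "tangent_line K (pt (a * x) (b * y))
      = {pt (a * x) (b * y) + r *\<^sub>R ((- (a * y)) *\<^sub>R e1 + (b * x) *\<^sub>R e2) |r. True}"
  proof (intro equalityI subsetI)
    fix p assume p: "p \<in> tangent_line K (pt (a * x) (b * y))"
    obtain u w where "p = pt (a * u) (b * w)" using scaled_coordinates ab by blast
    then show "p \<in> {pt (a * x) (b * y) + r *\<^sub>R ((- (a * y)) *\<^sub>R e1 + (b * x) *\<^sub>R e2) |r. True}"
      using line fw p by blast
  qed (use bw in auto)
qed

section \<open>Joachimsthal's integral\<close>

text \<open>A chord has squared length \<open>g * q\<close>, and its cross product with the tangent
  direction is \<open>a b g\<close> up to sign. By Lagrange's identity the squared inner product is
  \<open>d * (g * q) - (a * b * g)\<^sup>2\<close>. In the squared reflection law the terms with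
  \<open>d\<close> cancel, which leaves the equality of \<open>g / q\<close> for both
  chords.\<close>

lemma reflection_in_ellipse:
  assumes ab: "0 < a" "0 < b" and K: "\<And>x y. pt (a * x) (b * y) \<in> K \<longleftrightarrow> x\<^sup>2 + y\<^sup>2 = 1"
    and unit: "x\<^sup>2 + y\<^sup>2 = 1" "x1\<^sup>2 + y1\<^sup>2 = 1" "x2\<^sup>2 + y2\<^sup>2 = 1"
    and refl: "reflection_law (tangent_line K (pt (a * x) (b * y)))
      (pt (a * x1) (b * y1)) (pt (a * x) (b * y)) (pt (a * x2) (b * y2))"
  shows "(1 - x * x1 - y * y1) * (a\<^sup>2 + b\<^sup>2 - (a\<^sup>2 - b\<^sup>2) * (x * x2 - y * y2))
    = (1 - x * x2 - y * y2) * (a\<^sup>2 + b\<^sup>2 - (a\<^sup>2 - b\<^sup>2) * (x * x1 - y * y1))"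
proof -
  let ?P = "pt (a * x) (b * y)"
  let ?v = "(- (a * y)) *\<^sub>R e1 + (b * x) *\<^sub>R e2"
  define g where "g x' y' = 1 - x * x' - y * y'" for x' y'
  define q where "q x' y' = a\<^sup>2 + b\<^sup>2 - (a\<^sup>2 - b\<^sup>2) * (x * x' - y * y')" for x' y'
  define d where "d = a\<^sup>2 * y\<^sup>2 + b\<^sup>2 * x\<^sup>2"
  have n: "(norm (pt (a * x') (b * y') - ?P))\<^sup>2 = g x' y' * q x' y'" if "x'\<^sup>2 + y'\<^sup>2 = 1" for x' y'
    unfolding norm_pt_diff g_def q_def unit_circle_chord[OF unit(1) that, symmetric] by algebra
  have i: "((pt (a * x') (b * y') - ?P) \<bullet> ?v)\<^sup>2 = d * (g x' y' * q x' y') - (a * b * g x' y')\<^sup>2"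
    if "x'\<^sup>2 + y'\<^sup>2 = 1" for x' y'
  proof -
    have "((pt (a * x') (b * y') - ?P) \<bullet> ?v)
        = (a * x' - a * x) * (- (a * y)) + (b * y' - b * y) * (b * x)"
      unfolding pt_diff inner_frame ..
    moreover have "g x' y' * q x' y' = a\<^sup>2 * (x' - x)\<^sup>2 + b\<^sup>2 * (y' - y)\<^sup>2"
      unfolding g_def q_def unit_circle_chord[OF unit(1) that] ..
    moreover have "g x' y' = x * (x - x') + y * (y - y')" unfolding g_def using unit(1) by algebra
    ultimately show ?thesis unfolding d_def by algebra
  qed
  have ne: "x \<noteq> x1 \<or> y \<noteq> y1" "x \<noteq> x2 \<or> y \<noteq> y2" using refl unfolding reflection_law_def by auto
  have pos: "0 < g x1 y1" "0 < g x2 y2"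
    unfolding g_def using unit_circle_inner_less[OF unit(1,2) ne(1)]
      unit_circle_inner_less[OF unit(1,3) ne(2)] by auto
  \<comment> \<open>After squaring, it no longer matters on which side of the tangent line the chords lie.\<close>
  have "((pt (a * x1) (b * y1) - ?P) \<bullet> ?v)\<^sup>2 * (norm (pt (a * x2) (b * y2) - ?P))\<^sup>2
      = ((pt (a * x2) (b * y2) - ?P) \<bullet> ?v)\<^sup>2 * (norm (pt (a * x1) (b * y1) - ?P))\<^sup>2"
    by (rule reflection_law_squares[OF refl])
       (use tangent_line_ellipse(2)[OF ab K unit(1)] in auto)
  then have "a\<^sup>2 * b\<^sup>2 * g x1 y1 * g x2 y2 * (g x1 y1 * q x2 y2 - g x2 y2 * q x1 y1) = 0"
    unfolding n[OF unit(2)] n[OF unit(3)] i[OF unit(2)] i[OF unit(3)] by algebra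
  then have "g x1 y1 * q x2 y2 = g x2 y2 * q x1 y1" using ab pos by simp
  then show ?thesis unfolding g_def q_def .
qed

subsection \<open>Four-periodic trajectories\<close>

lemma billiard_quadrilateral_coordinates:
  assumes ab: "0 < b" "b \<le> a" and K: "\<And>x y. pt (a * x) (b * y) \<in> E \<longleftrightarrow> x\<^sup>2 + y\<^sup>2 = 1"
    and bill: "billiard_in_ellipse E A B C D" and conv: "convex_quadrilateral A B C D"
  obtains x y x' y' where "x\<^sup>2 + y\<^sup>2 = 1" "x'\<^sup>2 + y'\<^sup>2 = 1" "b\<^sup>2 * (x * x') + a\<^sup>2 * (y * y') = 0"
    and "A = pt (a * x) (b * y)" "B = pt (a * x') (b * y')"
    and "C = pt (a * - x) (b * - y)" "D = pt (a * - x') (b * - y')"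
proof -
  have a: "0 < a" using ab by simp
  obtain x0 y0 where A: "A = pt (a * x0) (b * y0)" using scaled_coordinates[OF a ab(1)] .
  obtain x1 y1 where B: "B = pt (a * x1) (b * y1)" using scaled_coordinates[OF a ab(1)] .
  obtain x2 y2 where C: "C = pt (a * x2) (b * y2)" using scaled_coordinates[OF a ab(1)] .
  obtain x3 y3 where D: "D = pt (a * x3) (b * y3)" using scaled_coordinates[OF a ab(1)] .
  have "A \<in> E" "B \<in> E" "C \<in> E" "D \<in> E"
    using bill by (auto simp: billiard_in_ellipse_def corners_def)
  then have u: "x0\<^sup>2 + y0\<^sup>2 = 1" "x1\<^sup>2 + y1\<^sup>2 = 1" "x2\<^sup>2 + y2\<^sup>2 = 1" "x3\<^sup>2 + y3\<^sup>2 = 1"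
    by (simp_all add: A B C D K)
  have nc: "\<not> collinear {D, A, B}" "\<not> collinear {A, B, C}"
    using conv by (auto simp: convex_quadrilateral_def corners_def)
  have ne: "x0 \<noteq> x2 \<or> y0 \<noteq> y2" "x1 \<noteq> x3 \<or> y1 \<noteq> y3" "x0 \<noteq> x1 \<or> y0 \<noteq> y1" "x1 \<noteq> x2 \<or> y1 \<noteq> y2"
    using not_collinear_distinct[OF nc(1)] not_collinear_distinct[OF nc(2)] A B C D by auto
  have refl: "reflection_law (tangent_line E A) D A B" "reflection_law (tangent_line E B) A B C"
    "reflection_law (tangent_line E C) B C D"
    using bill by (auto simp: billiard_in_ellipse_def corners_def)
  define g where "g x y x' y' = 1 - x * x' - y * y'" for x y x' y' :: real
  define q where "q x y x' y' = a\<^sup>2 + b\<^sup>2 - (a\<^sup>2 - b\<^sup>2) * (x * x' - y * y')" for x y x' y' :: real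
  have g_commute: "g x y x' y' = g x' y' x y" and q_commute: "q x y x' y' = q x' y' x y" for x y x' y'
    by (simp_all add: g_def q_def mult.commute)
  \<comment> \<open>As \<open>x x' - y y' \<le> 1\<close> and \<open>b \<le> a\<close>,
    \<open>q\<close> is at least \<open>2 * b\<^sup>2\<close>.\<close>
  have q_pos: "0 < q x y x' y'" if "x\<^sup>2 + y\<^sup>2 = 1" "x'\<^sup>2 + y'\<^sup>2 = 1" for x y x' y'
  proof -
    have "0 \<le> (x - x')\<^sup>2 + (y + y')\<^sup>2" by simp
    also have "\<dots> = 2 - 2 * (x * x' - y * y')" using that by algebra
    finally have "(a\<^sup>2 - b\<^sup>2) * (x * x' - y * y') \<le> (a\<^sup>2 - b\<^sup>2) * 1"
      using ab by (intro mult_left_mono) (auto simp: power_mono)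
    then show ?thesis using ab unfolding q_def by (smt (verit) zero_less_power)
  qed
  have r0: "g x0 y0 x3 y3 * q x0 y0 x1 y1 = g x0 y0 x1 y1 * q x0 y0 x3 y3"
    using reflection_in_ellipse[OF a ab(1) K u(1,4,2)] refl(1) by (simp add: A B D g_def q_def)
  have r1: "g x1 y1 x0 y0 * q x1 y1 x2 y2 = g x1 y1 x2 y2 * q x1 y1 x0 y0"
    using reflection_in_ellipse[OF a ab(1) K u(2,1,3)] refl(2) by (simp add: A B C g_def q_def)
  have r2: "g x2 y2 x1 y1 * q x2 y2 x3 y3 = g x2 y2 x3 y3 * q x2 y2 x1 y1"
    using reflection_in_ellipse[OF a ab(1) K u(3,2,4)] refl(3) by (simp add: B C D g_def q_def)
  \<comment> \<open>The squared length of the chord is \<open>g * q\<close>, so \<open>J\<close> is the square of Joachimsthal's integral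
    \<open>g / sqrt (g * q)\<close>.\<close>
  define J where "J = g x0 y0 x1 y1 / q x0 y0 x1 y1"
  have J01: "g x0 y0 x1 y1 = J * q x0 y0 x1 y1"
    using q_pos[OF u(1,2)] by (simp add: J_def)
  have J12: "g x1 y1 x2 y2 = J * q x1 y1 x2 y2"
    using r1 J01 q_pos[OF u(1,2)] by (simp add: g_commute[of x1 y1 x0] q_commute[of x1 y1 x0])
  have J23: "g x2 y2 x3 y3 = J * q x2 y2 x3 y3"
    using r2 J12 q_pos[OF u(2,3)] by (simp add: g_commute[of x2 y2 x1] q_commute[of x2 y2 x1])
  have J30: "g x3 y3 x0 y0 = J * q x3 y3 x0 y0"
    using r0 J01 q_pos[OF u(1,2)] by (simp add: g_commute[of x3] q_commute[of x3])
  define al be ga where "al = 1 - J * (a\<^sup>2 - b\<^sup>2)" and "be = 1 + J * (a\<^sup>2 - b\<^sup>2)"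
    and "ga = 1 - J * (a\<^sup>2 + b\<^sup>2)"
  have e: "al * (x * x') + be * (y * y') = ga" if "g x y x' y' = J * q x y x' y'" for x y x' y'
    using that unfolding al_def be_def ga_def g_def q_def by algebra
  have "0 < g x0 y0 x1 y1"
    unfolding g_def using unit_circle_inner_less[OF u(1,2) ne(3)] by simp
  then have "0 \<le> J" using q_pos[OF u(1,2)] by (simp add: J_def)
  moreover have "0 \<le> a\<^sup>2 - b\<^sup>2" using ab by (simp add: power_mono)
  \<comment> \<open>Only \<open>be\<close> has a definite sign so far: \<open>al\<close> vanishes if
    \<open>J * (a\<^sup>2 - b\<^sup>2) = 1\<close>, the case in which the crossing of the diagonals
    matters.\<close>
  ultimately have be: "be > 0" unfolding be_def by (smt (verit) mult_nonneg_nonneg)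
  have cross: "y0 = y1" if "y0 = y2" "y1 = y3"
  proof -
    obtain z where "z \<in> open_segment A C" "z \<in> open_segment B D"
      using conv by (auto simp: convex_quadrilateral_def)
    then have "\<exists>s. z = (1 - s) *\<^sub>R A + s *\<^sub>R C" "\<exists>t. z = (1 - t) *\<^sub>R B + t *\<^sub>R D"
      unfolding in_segment by blast+
    then obtain s t where "(1 - s) *\<^sub>R A + s *\<^sub>R C = (1 - t) *\<^sub>R B + t *\<^sub>R D" by metis
    then have "(1 - s) * (b * y0) + s * (b * y2) = (1 - t) * (b * y1) + t * (b * y3)"
      by (simp add: A B C D pt_combination pt_eq_iff)
    moreover have "(1 - s) * (b * y2) + s * (b * y2) = b * y2"
      "(1 - t) * (b * y3) + t * (b * y3) = b * y3"
      by algebra+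
    ultimately have "b * y2 = b * y3" unfolding that by metis
    then show ?thesis using ab that by simp
  qed
  have ga: "ga = 0"
    by (rule common_polar_line[OF u ne _ e[OF J01] e[OF J12] e[OF J23] e[OF J30] cross])
      (use be in auto)
  \<comment> \<open>\<open>ga = 0\<close> means \<open>J = 1 / (a\<^sup>2 + b\<^sup>2)\<close>,
    which determines \<open>al\<close> and \<open>be\<close>.\<close>
  have al': "(a\<^sup>2 + b\<^sup>2) * al = 2 * b\<^sup>2" and be': "(a\<^sup>2 + b\<^sup>2) * be = 2 * a\<^sup>2"
    using ga unfolding al_def be_def ga_def by algebra+
  then have al: "al \<noteq> 0" using ab by auto
  have 2: "x2 = - x0 \<and> y2 = - y0"
  proof (rule unit_circle_antipodal[OF u(1,3) ne(1)])
    show "(al * x1) * x0 + (be * y1) * y0 = 0" "(al * x1) * x2 + (be * y1) * y2 = 0"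
      using e[OF J01] e[OF J12] ga by (simp_all add: algebra_simps)
    show "al * x1 \<noteq> 0 \<or> be * y1 \<noteq> 0" using al be u(2) by auto
  qed
  have 3: "x3 = - x1 \<and> y3 = - y1"
  proof (rule unit_circle_antipodal[OF u(2,4) ne(2)])
    show "(al * x0) * x1 + (be * y0) * y1 = 0" "(al * x0) * x3 + (be * y0) * y3 = 0"
      using e[OF J01] e[OF J30] ga by (simp_all add: algebra_simps)
    show "al * x0 \<noteq> 0 \<or> be * y0 \<noteq> 0" using al be u(1) by auto
  qed
  have "b\<^sup>2 * (x0 * x1) + a\<^sup>2 * (y0 * y1) = 0"
    using e[OF J01] ga al' be' by algebra
  then show thesis using that u(1,2) A B C D 2 3 by simp
qed

text \<open>The intersection point of the tangent lines at \<open>(a x, b y)\<close> and \<open>(a x', b y')\<close>, a point on the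
  line through the midpoint of the chord.  Junk for antipodal points, where the denominator is \<open>0\<close>.\<close>

definition tangent_meet :: "real \<Rightarrow> real \<Rightarrow> real \<Rightarrow> real \<Rightarrow> real \<Rightarrow> real \<Rightarrow> plane"
  where "tangent_meet a b x y x' y'
    = pt (a * ((x + x') / (1 + (x * x' + y * y')))) (b * ((y + y') / (1 + (x * x' + y * y'))))"

section \<open>The circumscribed rectangle\<close>

text \<open>In scaled coordinates the neighbours of the vertex are \<open>(- x', - y')\<close> and
  \<open>(x', y')\<close>. Along \<open>?v\<close> the two intersection points have the parameters
  \<open>- d / (1 - m)\<close> and \<open>d / (1 + m)\<close>, of opposite signs as
  \<open>- 1 < m\<close> and \<open>m < 1\<close>; so the vertex lies strictly between them.\<close>

lemma tangent_line_through_meets: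
  assumes ab: "0 < a" "0 < b" and K: "\<And>x y. pt (a * x) (b * y) \<in> E \<longleftrightarrow> x\<^sup>2 + y\<^sup>2 = 1"
    and unit: "x\<^sup>2 + y\<^sup>2 = 1" "x'\<^sup>2 + y'\<^sup>2 = 1" and conj: "b\<^sup>2 * (x * x') + a\<^sup>2 * (y * y') = 0"
  shows "tangent_line E (pt (a * x) (b * y))
      = affine hull {tangent_meet a b (- x') (- y') x y, tangent_meet a b x y x' y'}"
    and "pt (a * x) (b * y)
      \<in> open_segment (tangent_meet a b (- x') (- y') x y) (tangent_meet a b x y x' y')"
proof -
  let ?P = "pt (a * x) (b * y)" and ?v = "(- (a * y)) *\<^sub>R e1 + (b * x) *\<^sub>R e2"
  let ?Q = "tangent_meet a b (- x') (- y') x y" and ?R = "tangent_meet a b x y x' y'"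
  define m d where "m = x * x' + y * y'" and "d = x * y' - x' * y"
  have m: "- 1 < m" "m < 1" and d: "d \<noteq> 0"
    unfolding m_def d_def using conjugate_bounds[OF ab unit conj] by auto
  \<comment> \<open>\<open>(m, d)\<close> are the coordinates of \<open>(x', y')\<close> in the
    orthonormal basis \<open>(x, y)\<close>, \<open>(- y, x)\<close>.\<close>
  have dy: "x' - m * x = - d * y" "y' - m * y = d * x"
    unfolding m_def d_def using unit by algebra+
  have R: "?R = ?P + (d / (1 + m)) *\<^sub>R ?v"
  proof -
    have "(x + x') / (1 + m) = x - d / (1 + m) * y" "(y + y') / (1 + m) = y + d / (1 + m) * x"
      using m dy by (simp_all add: field_simps)
    then show ?thesis
      unfolding pt_shift tangent_meet_def m_def by (simp only:) (simp add: algebra_simps)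
  qed
  have Q: "?Q = ?P + (- d / (1 - m)) *\<^sub>R ?v"
  proof -
    have "(- x' + x) / (1 - m) = x + d / (1 - m) * y" "(- y' + y) / (1 - m) = y - d / (1 - m) * x"
      using m dy by (simp_all add: field_simps)
    moreover have "1 + (- x' * x + - y' * y) = 1 - m" unfolding m_def by simp
    ultimately show ?thesis
      unfolding pt_shift tangent_meet_def by (simp only:) (simp add: algebra_simps)
  qed
  have "?v \<bullet> ?v = a\<^sup>2 * y\<^sup>2 + b\<^sup>2 * x\<^sup>2" unfolding inner_frame by algebra
  moreover have "a\<^sup>2 * y\<^sup>2 + b\<^sup>2 * x\<^sup>2 \<noteq> 0"
    using ab unit(1) by (auto simp: add_nonneg_eq_0_iff)
  ultimately have v: "?v \<noteq> 0" by auto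
  \<comment> \<open>The sign of \<open>d\<close> is the sense of rotation about the centre, and
    decides the order of the two intersection points along \<open>?v\<close>.\<close>
  have "affine hull {?Q, ?R} = {?P + r *\<^sub>R ?v |r. True} \<and> ?P \<in> open_segment ?Q ?R"
  proof (cases "d > 0")
    case True
    then show ?thesis using line_through_points[OF Q R _ _ v] m by simp
  next
    case False
    then have "d < 0" using d by simp
    then show ?thesis using line_through_points[OF R Q _ _ v] m
      by (simp add: insert_commute open_segment_commute divide_neg_pos)
  qed
  then show "tangent_line E ?P = affine hull {?Q, ?R}" "?P \<in> open_segment ?Q ?R"
    using tangent_line_ellipse(2)[OF ab K unit(1)] by auto
qed

text \<open>The diagonals bisect each other at \<open>Z\<close> and have equal length, so the angles
  are right by Thales.\<close>

lemma rectangle_pt: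
  assumes "r1\<^sup>2 + r2\<^sup>2 = s1\<^sup>2 + s2\<^sup>2" "pt r1 r2 \<noteq> pt s1 s2" "pt r1 r2 \<noteq> pt (- s1) (- s2)"
  shows "rectangle (pt (- s1) (- s2)) (pt r1 r2) (pt s1 s2) (pt (- r1) (- r2))"
proof -
  have 1: "orthogonal (pt r1 r2 - pt (- s1) (- s2)) (pt (- r1) (- r2) - pt (- s1) (- s2))"
    "orthogonal (pt (- s1) (- s2) - pt r1 r2) (pt s1 s2 - pt r1 r2)"
    unfolding orthogonal_def pt_diff inner_frame using assms(1) by algebra+
  have "\<not> collinear {pt (- s1) (- s2), pt r1 r2, pt s1 s2}"
    using orthogonal_imp_not_collinear[OF 1(2)] assms(2,3) by metis
  moreover have "parallel (pt (- s1) (- s2)) (pt r1 r2) (pt s1 s2) (pt (- r1) (- r2))"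
    unfolding parallel_def
    by (intro conjI exI[of _ "- 1"]) (use assms in \<open>auto simp: pt_eq_iff pt_diff algebra_simps\<close>)
  moreover have "parallel (pt r1 r2) (pt s1 s2) (pt (- r1) (- r2)) (pt (- s1) (- s2))"
    unfolding parallel_def
    by (intro conjI exI[of _ "- 1"]) (use assms in \<open>auto simp: pt_eq_iff pt_diff algebra_simps\<close>)
  ultimately show ?thesis using 1(1) unfolding rectangle_def parallelogram_def by blast
qed

lemma parallel_pt:
  assumes "pt u w \<noteq> pt u' w'" "pt p q \<noteq> pt p' q'" "p' - p = k * (u' - u)" "q' - q = k * (w' - w)"
  shows "parallel (pt u w) (pt u' w') (pt p q) (pt p' q')"
  unfolding parallel_def using assms(1,2)
  by (intro conjI exI[of _ k]) (simp_all add: pt_diff assms(3,4) scaleR_add_right)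

section \<open>The caustic\<close>

text \<open>The chord lies on the polar line of the intersection point of the tangent lines at its
  ends, a point at distance \<open>h\<close> from the centre. Dividing that point by
  \<open>h\<close> gives a unit vector \<open>(u, w)\<close>, and the polar line is the tangent line
  of \<open>K\<close> at \<open>(a\<^sup>2 / h * u, b\<^sup>2 / h * w)\<close>.\<close>

lemma tangent_confocal_ellipse:
  assumes ab: "0 < a" "0 < b" and K: "\<And>x y. pt (a\<^sup>2 / h * x) (b\<^sup>2 / h * y) \<in> K \<longleftrightarrow> x\<^sup>2 + y\<^sup>2 = 1"
    and h: "0 < h" "h\<^sup>2 = a\<^sup>2 + b\<^sup>2"
    and unit: "x\<^sup>2 + y\<^sup>2 = 1" "x'\<^sup>2 + y'\<^sup>2 = 1" and conj: "b\<^sup>2 * (x * x') + a\<^sup>2 * (y * y') = 0"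
  shows "\<exists>p\<in>K. closed_segment (pt (a * x) (b * y)) (pt (a * x') (b * y')) \<subseteq> tangent_line K p"
proof -
  define m where "m = x * x' + y * y'"
  have m: "1 + m > 0" unfolding m_def using conjugate_bounds(2)[OF ab unit conj] by simp
  define u w where "u = a * ((x + x') / (1 + m)) / h" and "w = b * ((y + y') / (1 + m)) / h"
  have "u\<^sup>2 + w\<^sup>2 = (a\<^sup>2 + b\<^sup>2) / h\<^sup>2"
    unfolding u_def w_def m_def power_divide add_divide_distrib[symmetric]
      norm_tangent_meet[OF ab unit conj] ..
  then have uw: "u\<^sup>2 + w\<^sup>2 = 1" unfolding h(2)[symmetric] using h(1) by simp
  have pos: "0 < a\<^sup>2 / h" "0 < b\<^sup>2 / h" using ab h by auto
  have "closed_segment (pt (a * x) (b * y)) (pt (a * x') (b * y'))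
    \<subseteq> tangent_line K (pt (a\<^sup>2 / h * u) (b\<^sup>2 / h * w))"
  proof
    fix z assume "z \<in> closed_segment (pt (a * x) (b * y)) (pt (a * x') (b * y'))"
    then obtain t where "z = (1 - t) *\<^sub>R pt (a * x) (b * y) + t *\<^sub>R pt (a * x') (b * y')"
      by (auto simp: in_segment)
    moreover have "(1 - t) *\<^sub>R pt (a * x) (b * y) + t *\<^sub>R pt (a * x') (b * y')
        = pt ((1 - t) * (a * x) + t * (a * x')) ((1 - t) * (b * y) + t * (b * y'))"
      by (rule pt_combination) simp
    ultimately have z: "z = pt (a * ((1 - t) * x + t * x')) (b * ((1 - t) * y + t * y'))"
      by (simp add: algebra_simps)
    define p q where "p = (1 - t) * x + t * x'" and "q = (1 - t) * y + t * y'"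
    have z': "z = pt (a\<^sup>2 / h * (h * p / a)) (b\<^sup>2 / h * (h * q / b))"
      unfolding z p_def[symmetric] q_def[symmetric] using ab h by (simp add: power2_eq_square)
    have "(x + x') * p + (y + y') * q = 1 + m"
      unfolding p_def q_def m_def using unit by algebra
    moreover have "u * (h * p / a) = (x + x') * p / (1 + m)" "w * (h * q / b) = (y + y') * q / (1 + m)"
      unfolding u_def w_def using ab h by simp_all
    ultimately have "u * (h * p / a) + w * (h * q / b) = 1"
      using m by (simp flip: add_divide_distrib)
    then show "z \<in> tangent_line K (pt (a\<^sup>2 / h * u) (b\<^sup>2 / h * w))"
      unfolding z' using tangent_line_ellipse(1)[OF pos K uw] by blast
  qed
  moreover have "pt (a\<^sup>2 / h * u) (b\<^sup>2 / h * w) \<in> K" using K uw by blast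
  ultimately show ?thesis by blast
qed

text \<open>Write the line of the side as \<open>n1 X + n2 Y = 1\<close>. Tangency to the hyperbola
  reads \<open>s\<^sup>2 * n1\<^sup>2 + (s\<^sup>2 - c\<^sup>2) * n2\<^sup>2 = 1\<close>, which
  forces \<open>1 \<le> c\<^sup>2 * n1\<^sup>2\<close>. The director circle gives
  \<open>a^4 * n1\<^sup>2 + b^4 * n2\<^sup>2 = a\<^sup>2 + b\<^sup>2\<close>, hence
  \<open>a^4 \<le> c\<^sup>2 * (a\<^sup>2 + b\<^sup>2) = a^4 - b^4\<close>.\<close>

lemma not_tangent_confocal_hyperbola:
  assumes ab: "0 < a" "0 < b" and c: "c\<^sup>2 = a\<^sup>2 - b\<^sup>2" and s: "0 < s" "s < c"
    and unit: "x\<^sup>2 + y\<^sup>2 = 1" "x'\<^sup>2 + y'\<^sup>2 = 1" and conj: "b\<^sup>2 * (x * x') + a\<^sup>2 * (y * y') = 0"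
    and p: "p \<in> hyperbola (pt (- c) 0) (pt c 0) s"
  shows "\<not> closed_segment (pt (a * x) (b * y)) (pt (a * x') (b * y'))
    \<subseteq> tangent_line (hyperbola (pt (- c) 0) (pt c 0) s) p"
proof
  let ?H = "hyperbola (pt (- c) 0) (pt c 0) s"
  assume sub: "closed_segment (pt (a * x) (b * y)) (pt (a * x') (b * y')) \<subseteq> tangent_line ?H p"
  obtain u w where uw: "p = pt u w" using coordinates .
  define k where "k = s\<^sup>2 - c\<^sup>2"
  have k: "k < 0" unfolding k_def using s by (simp add: power_strict_mono)
  note quad = hyperbola_imp_quadric[where c = c and s = s, folded k_def]
  define n1 n2 where "n1 = u / s\<^sup>2" and "n2 = w / k"
  have n: "u = s\<^sup>2 * n1" "w = k * n2" unfolding n1_def n2_def using s k by auto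
  have "pt (a * x) (b * y) \<in> tangent_line ?H (pt u w)" "pt (a * x') (b * y') \<in> tangent_line ?H (pt u w)"
    using sub unfolding uw by auto
  note this[THEN tangent_line_quadric[OF quad, rotated]]
  then have "s\<^sup>2 * k * (n1 * (a * x) + n2 * (b * y) - 1) = 0"
    "s\<^sup>2 * k * (n1 * (a * x') + n2 * (b * y') - 1) = 0"
    unfolding n by algebra+
  then have "n1 * (a * x) + n2 * (b * y) = 1" "n1 * (a * x') + n2 * (b * y') = 1"
    using s k by auto
  then have t: "(a * n1) * x + (b * n2) * y = 1" "(a * n1) * x' + (b * n2) * y' = 1"
    by (simp_all add: mult_ac)
  have "k * u\<^sup>2 + s\<^sup>2 * w\<^sup>2 = s\<^sup>2 * k" using quad p uw by blast
  then have "s\<^sup>2 * k * (s\<^sup>2 * n1\<^sup>2 + k * n2\<^sup>2 - 1) = 0"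
    unfolding n by algebra
  then have on: "s\<^sup>2 * n1\<^sup>2 + k * n2\<^sup>2 = 1" using s k by simp
  define m d where "m = x * x' + y * y'" and "d = x * y' - x' * y"
  have m: "1 + m \<noteq> 0" and d: "d \<noteq> 0"
    unfolding m_def d_def using conjugate_bounds[OF ab unit conj] by auto
  \<comment> \<open>Cramer's rule: the line through the two points is unique, hence the polar line
    of the intersection point of their tangent lines.\<close>
  have n': "(1 + m) * p = x + x'" "(1 + m) * q = y + y'" if "p * x + q * y = 1" "p * x' + q * y' = 1" for p q
  proof -
    have "p * d = y' - y" "q * d = x - x'" unfolding d_def using that by algebra+
    moreover have "(x + x') * d = (1 + m) * (y' - y)" "(y + y') * d = (1 + m) * (x - x')"
      unfolding d_def m_def using unit by algebra+
    ultimately have "((1 + m) * p) * d = (x + x') * d" "((1 + m) * q) * d = (y + y') * d" by simp_all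
    then show "(1 + m) * p = x + x'" "(1 + m) * q = y + y'" using d by simp_all
  qed
  note n' = n'[OF t]
  have "a\<^sup>2 * ((1 + m) * (a * n1))\<^sup>2 + b\<^sup>2 * ((1 + m) * (b * n2))\<^sup>2 = (a\<^sup>2 + b\<^sup>2) * (1 + m)\<^sup>2"
    unfolding n' using director_circle[OF unit conj] unfolding m_def by (simp only: add.assoc)
  then have "(1 + m)\<^sup>2 * (a\<^sup>2 * (a * n1)\<^sup>2 + b\<^sup>2 * (b * n2)\<^sup>2) = (1 + m)\<^sup>2 * (a\<^sup>2 + b\<^sup>2)"
    unfolding power_mult_distrib[of "1 + m"] by (simp add: distrib_left mult.commute mult.left_commute)
  then have "a\<^sup>2 * (a * n1)\<^sup>2 + b\<^sup>2 * (b * n2)\<^sup>2 = a\<^sup>2 + b\<^sup>2" using m by simp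
  then have dir: "a^4 * n1\<^sup>2 + b^4 * n2\<^sup>2 = a\<^sup>2 + b\<^sup>2"
    by (simp add: power_mult_distrib flip: mult.assoc power_add)
  have "1 \<le> s\<^sup>2 * n1\<^sup>2" using on k by (smt (verit) mult_nonpos_nonneg zero_le_power2)
  also have "\<dots> \<le> c\<^sup>2 * n1\<^sup>2" using s by (intro mult_right_mono power_mono) auto
  finally have "a^4 * 1 \<le> a^4 * (c\<^sup>2 * n1\<^sup>2)" by (intro mult_left_mono) auto
  also have "\<dots> = c\<^sup>2 * (a^4 * n1\<^sup>2)" by algebra
  also have "\<dots> \<le> c\<^sup>2 * (a\<^sup>2 + b\<^sup>2)"
    using dir by (intro mult_left_mono) (auto simp flip: dir)
  also have "\<dots> = a^4 - b^4" unfolding c by algebra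
  finally show False using ab by simp
qed

section \<open>The trajectory in principal axes\<close>

lemma four_periodic_billiard:
  assumes c: "0 \<le> c" "c < a" and E: "E = ellipse (pt (- c) 0) (pt c 0) a"
    and bill: "billiard_in_ellipse E A B C D" and conv: "convex_quadrilateral A B C D"
  shows "((\<exists>K. caustic (pt (- c) 0) (pt c 0) A B C D K) \<and>
          (\<forall>K. caustic (pt (- c) 0) (pt c 0) A B C D K \<longrightarrow> is_ellipse (pt (- c) 0) (pt c 0) K)) \<and>
    parallelogram A B C D \<and>
    (\<exists>Q R S T. rectangle Q R S T \<and>
      tangent_line E A = affine hull {Q, R} \<and>
      tangent_line E B = affine hull {R, S} \<and>
      tangent_line E C = affine hull {S, T} \<and>
      tangent_line E D = affine hull {T, Q} \<and>
      billiard_in_table Q R S T A B C D \<and>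
      parallel Q S A B \<and> parallel Q S C D \<and>
      parallel R T B C \<and> parallel R T D A)"
proof -
  define b where "b = sqrt (a\<^sup>2 - c\<^sup>2)"
  have "c\<^sup>2 < a\<^sup>2" using c by (simp add: power_strict_mono)
  then have b: "0 < b" "b\<^sup>2 = a\<^sup>2 - c\<^sup>2" by (simp_all add: b_def)
  have a: "0 < a" using c by simp
  have "b\<^sup>2 \<le> a\<^sup>2" unfolding b(2) by simp
  then have ba: "b \<le> a" by (rule power2_le_imp_le) (use a in simp)
  have K: "pt (a * x) (b * y) \<in> E \<longleftrightarrow> x\<^sup>2 + y\<^sup>2 = 1" for x y
    unfolding E using ellipse_iff[OF c b] .
  obtain x y x' y' where unit: "x\<^sup>2 + y\<^sup>2 = 1" "x'\<^sup>2 + y'\<^sup>2 = 1"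
    and conj: "b\<^sup>2 * (x * x') + a\<^sup>2 * (y * y') = 0"
    and A: "A = pt (a * x) (b * y)" and B: "B = pt (a * x') (b * y')"
    and C: "C = pt (a * - x) (b * - y)" and D: "D = pt (a * - x') (b * - y')"
    by (rule billiard_quadrilateral_coordinates[OF b(1) ba K bill conv])
  have unit_neg: "(- x)\<^sup>2 + (- y)\<^sup>2 = 1" "(- x')\<^sup>2 + (- y')\<^sup>2 = 1" using unit by simp_all
  have conj': "b\<^sup>2 * (x' * - x) + a\<^sup>2 * (y' * - y) = 0" "b\<^sup>2 * (- x * - x') + a\<^sup>2 * (- y * - y') = 0"
    "b\<^sup>2 * (- x' * x) + a\<^sup>2 * (- y' * y) = 0"
    using conj by (simp_all add: algebra_simps)
  have nc: "\<not> collinear {A, B, C}" "\<not> collinear {C, D, A}"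
    using conv by (auto simp: convex_quadrilateral_def corners_def)
  have distinct: "A \<noteq> B" "B \<noteq> C" "D \<noteq> A" "C \<noteq> D"
    using not_collinear_distinct[OF nc(1)] not_collinear_distinct[OF nc(2)] by blast+
  have "parallel A B C D" "parallel B C D A"
    unfolding A B C D
    by (rule parallel_pt[where k = "- 1"], use distinct[unfolded A B C D] in simp_all)+
  then have par: "parallelogram A B C D"
    unfolding parallelogram_def using nc(1) by blast

  define h where "h = sqrt (a\<^sup>2 + b\<^sup>2)"
  have pos: "0 < a\<^sup>2 + b\<^sup>2" using a by (simp add: add_pos_nonneg)
  then have h: "0 < h" "h\<^sup>2 = a\<^sup>2 + b\<^sup>2" by (simp_all add: h_def)
  \<comment> \<open>The semi-axes are \<open>a\<^sup>2 / h\<close> and \<open>b\<^sup>2 / h\<close>;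
    the foci are right because \<open>a^4 - b^4 = c\<^sup>2 * h\<^sup>2\<close>.\<close>
  define K where "K = ellipse (pt (- c) 0) (pt c 0) (a\<^sup>2 / h)"
  have "(c * h)\<^sup>2 = (a\<^sup>2)\<^sup>2 - (b\<^sup>2)\<^sup>2" using h b by algebra
  then have "(c * h)\<^sup>2 < (a\<^sup>2)\<^sup>2" using b(1) by simp
  then have "c * h < a\<^sup>2" by (rule power2_less_imp_less) simp
  then have ch: "c < a\<^sup>2 / h" using h by (simp add: pos_less_divide_eq)
  have bh: "0 < b\<^sup>2 / h" using b(1) h(1) by simp
  have bh2: "(b\<^sup>2 / h)\<^sup>2 = (a\<^sup>2 / h)\<^sup>2 - c\<^sup>2"
  proof -
    have "(a\<^sup>2)\<^sup>2 - c\<^sup>2 * h\<^sup>2 = (b\<^sup>2)\<^sup>2" using h b by algebra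
    then show ?thesis using h(1) by (simp add: power_divide field_simps)
  qed
  have K': "pt (a\<^sup>2 / h * x) (b\<^sup>2 / h * y) \<in> K \<longleftrightarrow> x\<^sup>2 + y\<^sup>2 = 1" for x y
    unfolding K_def using ellipse_iff[OF c(1) ch bh bh2] .
  have "(dist (pt (- c) 0) (pt c 0))\<^sup>2 = (2 * c)\<^sup>2"
    unfolding dist_norm norm_pt_diff by (simp add: power2_eq_square)
  then have df: "dist (pt (- c) 0) (pt c 0) = 2 * c"
    by (rule power2_eq_imp_eq) (use c(1) in simp_all)
  have tang: "\<exists>p\<in>K. closed_segment X Y \<subseteq> tangent_line K p" if "(X, Y) \<in> sides A B C D" for X Y
  proof -
    have "(X = A \<and> Y = B) \<or> (X = B \<and> Y = C) \<or> (X = C \<and> Y = D) \<or> (X = D \<and> Y = A)"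
      using that by (simp add: sides_def)
    then show ?thesis
      using tangent_confocal_ellipse[OF a b(1) K' h unit conj]
      tangent_confocal_ellipse[OF a b(1) K' h unit(2) unit_neg(1) conj'(1)]
      tangent_confocal_ellipse[OF a b(1) K' h unit_neg conj'(2)]
      tangent_confocal_ellipse[OF a b(1) K' h unit_neg(2) unit(1) conj'(3)]
      unfolding A[symmetric] B[symmetric] C[symmetric] D[symmetric] minus_minus by metis
  qed
  have "is_ellipse (pt (- c) 0) (pt c 0) K"
    unfolding is_ellipse_def df using ch K_def by (intro exI[of _ "a\<^sup>2 / h"]) simp
  then have ex: "caustic (pt (- c) 0) (pt c 0) A B C D K"
    unfolding caustic_def is_conic_def using tang by blast
  have all: "is_ellipse (pt (- c) 0) (pt c 0) K"
    if caustic: "caustic (pt (- c) 0) (pt c 0) A B C D K" for K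
  proof (rule ccontr)
    assume "\<not> ?thesis"
    then obtain s where s: "0 < 2 * s" "2 * s < 2 * c" "K = hyperbola (pt (- c) 0) (pt c 0) s"
      using caustic unfolding caustic_def is_conic_def is_hyperbola_def df by blast
    obtain p where "p \<in> K" "closed_segment A B \<subseteq> tangent_line K p"
      using caustic unfolding caustic_def sides_def by blast
    then show False
      using not_tangent_confocal_hyperbola[OF a b(1) _ _ _ unit conj] b s unfolding A B by auto
  qed

  \<comment> \<open>The tangent lines at \<open>A\<close>, \<open>B\<close> meet at
    \<open>(r1, r2)\<close> and those at \<open>B\<close>, \<open>C\<close> at
    \<open>(s1, s2)\<close>; central symmetry gives the other two vertices of the rectangle.\<close>
  define r1 r2 s1 s2 where "r1 = a * ((x + x') / (1 + (x * x' + y * y')))"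
    and "r2 = b * ((y + y') / (1 + (x * x' + y * y')))"
    and "s1 = a * ((x' - x) / (1 - (x * x' + y * y')))"
    and "s2 = b * ((y' - y) / (1 - (x * x' + y * y')))"
  have den: "1 + (x' * - x + y' * - y) = 1 - (x * x' + y * y')"
    "1 + (- x' * x + - y' * y) = 1 - (x * x' + y * y')"
    "1 + (- x * - x' + - y * - y') = 1 + (x * x' + y * y')"
    by (simp_all add: algebra_simps)
  have num: "k * ((- p + - q) / l) = - (k * ((p + q) / l))"
    "k * ((- p + q) / l) = - (k * ((p - q) / l))" for k l p q :: real
    by (simp_all add: add_divide_distrib diff_divide_distrib algebra_simps)
  have R: "tangent_meet a b x y x' y' = pt r1 r2"
    unfolding tangent_meet_def r1_def r2_def ..
  have S: "tangent_meet a b x' y' (- x) (- y) = pt s1 s2"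
    unfolding tangent_meet_def s1_def s2_def den by simp
  have T: "tangent_meet a b (- x) (- y) (- x') (- y') = pt (- r1) (- r2)"
    unfolding tangent_meet_def r1_def r2_def den num(1) ..
  have Q: "tangent_meet a b (- x') (- y') x y = pt (- s1) (- s2)"
    unfolding tangent_meet_def s1_def s2_def den num(2) ..
  note tA = tangent_line_through_meets[OF a b(1) K unit conj, folded A, unfolded Q R]
    and tB = tangent_line_through_meets[OF a b(1) K unit(2) unit_neg(1) conj'(1), folded B,
      unfolded minus_minus R S]
    and tC = tangent_line_through_meets[OF a b(1) K unit_neg conj'(2), folded C,
      unfolded minus_minus S T]
    and tD = tangent_line_through_meets[OF a b(1) K unit_neg(2) unit(1) conj'(3), folded D,
      unfolded minus_minus T Q]
  have nr: "r1\<^sup>2 + r2\<^sup>2 = a\<^sup>2 + b\<^sup>2"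
    unfolding r1_def r2_def using norm_tangent_meet[OF a b(1) unit conj] .
  have ns: "s1\<^sup>2 + s2\<^sup>2 = a\<^sup>2 + b\<^sup>2"
    using norm_tangent_meet[OF a b(1) unit(2) unit_neg(1) conj'(1)]
    unfolding s1_def s2_def den by simp
  have rect: "rectangle (pt (- s1) (- s2)) (pt r1 r2) (pt s1 s2) (pt (- r1) (- r2))"
    by (rule rectangle_pt) (use nr ns tA(2) tB(2) in auto)
  have refl: "reflection_law (tangent_line E P) X P Y" if "(X, P, Y) \<in> corners A B C D" for X P Y
    using that bill unfolding billiard_in_ellipse_def by blast
  have table: "billiard_in_table (pt (- s1) (- s2)) (pt r1 r2) (pt s1 s2) (pt (- r1) (- r2)) A B C D"
    unfolding billiard_in_table_def
  proof (clarify)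
    fix X P Y assume XPY: "(X, P, Y) \<in> corners A B C D"
    then have "P = A \<or> P = B \<or> P = C \<or> P = D" by (auto simp: corners_def)
    \<comment> \<open>Each side of the table spans the tangent line at the vertex on it, so both
      reflection laws are the same statement.\<close>
    then have "\<exists>U V. (U, V) \<in> sides (pt (- s1) (- s2)) (pt r1 r2) (pt s1 s2) (pt (- r1) (- r2)) \<and>
        P \<in> open_segment U V \<and> tangent_line E P = affine hull {U, V}"
      unfolding sides_def using tA tB tC tD by (elim disjE) blast+
    then show "\<exists>(U, V)\<in>sides (pt (- s1) (- s2)) (pt r1 r2) (pt s1 s2) (pt (- r1) (- r2)).
        P \<in> open_segment U V \<and> reflection_law (affine hull {U, V}) X P Y"
      using refl[OF XPY] by fastforce
  qed
  define m where "m = x * x' + y * y'"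
  have m: "1 + m \<noteq> 0" "1 - m \<noteq> 0"
    unfolding m_def using conjugate_bounds[OF a b(1) unit conj] by auto
  have cancel: "(1 + m) * (k * (l / (1 + m))) = k * l" "(1 - m) * (k * (l / (1 - m))) = k * l" for k l
    using m by simp_all
  \<comment> \<open>Seen from the centre, \<open>A + B\<close>, which equals \<open>B - C\<close>,
    and \<open>B - A\<close> are multiples of the two half-diagonals.\<close>
  have r': "a * x + a * x' = (1 + m) * r1" "b * y + b * y' = (1 + m) * r2"
    unfolding r1_def r2_def m_def[symmetric] cancel(1) by (simp_all add: distrib_left)
  have s': "a * x' - a * x = (1 - m) * s1" "b * y' - b * y = (1 - m) * s2"
    unfolding s1_def s2_def m_def[symmetric] cancel(2) by (simp_all add: right_diff_distrib)
  have QS: "pt (- s1) (- s2) \<noteq> pt s1 s2" and RT: "pt r1 r2 \<noteq> pt (- r1) (- r2)"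
    using nr ns pos by (auto simp: pt_eq_iff)
  have "parallel (pt (- s1) (- s2)) (pt s1 s2) A B"
    unfolding A B by (rule parallel_pt[OF QS, where k = "(1 - m) / 2"])
      (use distinct A B s' in auto)
  moreover have "parallel (pt (- s1) (- s2)) (pt s1 s2) C D"
    unfolding C D by (rule parallel_pt[OF QS, where k = "- (1 - m) / 2"])
      (use distinct C D s' in \<open>auto simp: algebra_simps\<close>)
  moreover have "parallel (pt r1 r2) (pt (- r1) (- r2)) B C"
    unfolding B C by (rule parallel_pt[OF RT, where k = "(1 + m) / 2"])
      (use distinct B C r' in auto)
  moreover have "parallel (pt r1 r2) (pt (- r1) (- r2)) D A"
    unfolding D A by (rule parallel_pt[OF RT, where k = "- (1 + m) / 2"])
      (use distinct D A r' in \<open>auto simp: algebra_simps\<close>)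
  ultimately show ?thesis
    using ex all par rect tA(1) tB(1) tC(1) tD(1) table
    by (intro conjI exI[of _ "pt (- s1) (- s2)"] exI[of _ "pt r1 r2"] exI[of _ "pt s1 s2"]
        exI[of _ "pt (- r1) (- r2)"] exI[of _ K] allI impI) assumption+
qed

end

section \<open>Reduction to principal axes\<close>

lemma axes_through_foci:
  obtains Z e1 e2 where "axes e1 e2"
    and "F1 = axes.pt Z e1 e2 (- (dist F1 F2 / 2)) 0" "F2 = axes.pt Z e1 e2 (dist F1 F2 / 2) 0"
proof -
  \<comment> \<open>For a circle the foci coincide, and any unit vector can serve as the first
    axis.\<close>
  obtain e :: plane where e: "norm e = 1" "F2 - F1 = dist F1 F2 *\<^sub>R e"
  proof (cases "F1 = F2")
    case True
    then show ?thesis using that[of "axis 1 1"] by simp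
  next
    case False
    then show ?thesis using that[of "(F2 - F1) /\<^sub>R dist F1 F2"] by (simp add: dist_norm norm_minus_commute)
  qed
  have "e \<bullet> e = 1" using e(1) by (simp add: norm_eq_1)
  then have unit: "e $ 1 * e $ 1 + e $ 2 * e $ 2 = 1" by (simp add: inner_vec_def sum_2)
  define e' :: plane where "e' = vector [- (e $ 2), e $ 1]"
  have ax: "axes e e'"
  proof
    show "e \<bullet> e = 1" "e' \<bullet> e' = 1" "e \<bullet> e' = 0"
      using unit by (simp_all add: inner_vec_def sum_2 e'_def)
    fix v :: plane
    have "v $ 1 = (v $ 1 * e $ 1 + v $ 2 * e $ 2) * e $ 1 + (v $ 2 * e $ 1 - v $ 1 * e $ 2) * - e $ 2"
      "v $ 2 = (v $ 1 * e $ 1 + v $ 2 * e $ 2) * e $ 2 + (v $ 2 * e $ 1 - v $ 1 * e $ 2) * e $ 1"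
      using unit by algebra+
    then show "v = (v \<bullet> e) *\<^sub>R e + (v \<bullet> e') *\<^sub>R e'"
      by (simp add: vec_eq_iff forall_2 inner_vec_def sum_2 e'_def)
  qed
  interpret axes "midpoint F1 F2" e e' using ax .
  have half: "(1 / 2 :: real) *\<^sub>R (F2 - F1) = (dist F1 F2 / 2) *\<^sub>R e" unfolding e(2) by simp
  have "F1 = pt (- (dist F1 F2 / 2)) 0" "F2 = pt (dist F1 F2 / 2) 0"
    unfolding pt_def scaleR_minus_left half[symmetric]
    by (simp_all add: midpoint_def vec_eq_iff field_simps)
  then show thesis using that ax by blast
qed

theorem lemma6p1:
  fixes F1 F2 A B C D :: plane and E :: "plane set"
  assumes "is_ellipse F1 F2 E"
    and "billiard_in_ellipse E A B C D"
    and "convex_quadrilateral A B C D"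
  shows "((\<exists>K. caustic F1 F2 A B C D K) \<and>
          (\<forall>K. caustic F1 F2 A B C D K \<longrightarrow> is_ellipse F1 F2 K)) \<and>
    parallelogram A B C D \<and>
    (\<exists>Q R S T. rectangle Q R S T \<and>
      tangent_line E A = affine hull {Q, R} \<and>
      tangent_line E B = affine hull {R, S} \<and>
      tangent_line E C = affine hull {S, T} \<and>
      tangent_line E D = affine hull {T, Q} \<and>
      billiard_in_table Q R S T A B C D \<and>
      parallel Q S A B \<and> parallel Q S C D \<and>
      parallel R T B C \<and> parallel R T D A)"
proof -
  obtain a where a: "dist F1 F2 < 2 * a" "E = ellipse F1 F2 a"
    using assms(1) unfolding is_ellipse_def by blast
  obtain Z e1 e2 where ax: "axes e1 e2" and F1: "F1 = axes.pt Z e1 e2 (- (dist F1 F2 / 2)) 0"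
    and F2: "F2 = axes.pt Z e1 e2 (dist F1 F2 / 2) 0"
    by (rule axes_through_foci)
  show ?thesis
    using axes.four_periodic_billiard[OF ax, of "dist F1 F2 / 2" a E Z A B C D, folded F1 F2]
      a assms(2,3) by simp
qed

end
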